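(* Let $F$ be Thompson's group with the elements $x_0,x_1,x_2,\ldots$, let $S\subset F$ be the set of all elements of the form $x_nu$ with $n\ge0$ and $u$ a (possibly empty) word over $\{x_0,x_1\}$, and let $\Gamma_S$ be the subgraph induced on $S$ of the right Cayley graph of $F$ with respect to $\{x_0,x_1\}$. Then the graph $\Gamma_S$ is non-amenable.
   Context: Thompson's group $F$ has the presentation $F\cong\langle x_0,x_1,x_2,\ldots \mid x_kx_n=x_{n+1}x_k,\ 0\le k<n\rangle$; it is generated by $x_0,x_1$, with $x_n=x_0^{n-1}x_1x_0^{-(n-1)}$ for $n\ge1$. (Concretely $F$ is the group of increasing piecewise linear homeomorphisms of $[0,1]$ with dyadic breakpoints and slopes integer powers of $2$, with product $(fg)(x)=g(f(x))$.) The right Cayley graph of $F$ with respect to $\{x_0,x_1\}$ has vertex set $F$ and, for each $g\in F$ and $i\in\{0,1\}$, an edge from $g$ to $gx_i$. The subgraph induced on $S$ has vertex set $S$ and all edges of the Cayley graph with both endpoints in $S$. For an infinite graph $\Gamma=(V,E)$ of bounded degree, the Cheeger constant is $h(\Gamma)=\inf_A|\partial A|/|A|$, where $A$ runs over all nonempty finite subsets of $V$ and $\partial A$ is the set of vertices of $V\setminus A$ that have a neighbor in $A$ (edge orientations and labels are ignored). $\Gamma$ is amenable if $h(\Gamma)=0$, and non-amenable otherwise. *)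

theory Defs
  imports Complex_Main "HOL-Algebra.Group" "Graph_Theory.Digraph_Component"
begin

section \<open>Groups given by generators and relations\<close>

text \<open>
  A letter \<open>(a, True)\<close> is the generator \<open>a\<close>, a letter \<open>(a, False)\<close> its formal inverse. A
  relation \<open>l = r\<close> between words is the pair \<open>(l, r)\<close>.
\<close>

type_synonym 'a gword = "('a \<times> bool) list"

inductive_set word_cong :: "('a gword \<times> 'a gword) set \<Rightarrow> ('a gword \<times> 'a gword) set"
  for R :: "('a gword \<times> 'a gword) set" where
  refl: "(u, u) \<in> word_cong R"
| sym: "(u, v) \<in> word_cong R \<Longrightarrow> (v, u) \<in> word_cong R"
| trans: "\<lbrakk>(u, v) \<in> word_cong R; (v, w) \<in> word_cong R\<rbrakk> \<Longrightarrow> (u, w) \<in> word_cong R"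
| cancel: "(p @ [(a, b), (a, \<not> b)] @ q, p @ q) \<in> word_cong R"
| rel: "(l, r) \<in> R \<Longrightarrow> (p @ l @ q, p @ r @ q) \<in> word_cong R"

definition word_class :: "('a gword \<times> 'a gword) set \<Rightarrow> 'a gword \<Rightarrow> 'a gword set" where
  "word_class R w = word_cong R `` {w}"

definition presented_group :: "('a gword \<times> 'a gword) set \<Rightarrow> 'a gword set monoid" where
  "presented_group R =
     \<lparr>carrier = UNIV // word_cong R,
      monoid.mult = (\<lambda>A B. \<Union>u\<in>A. \<Union>v\<in>B. word_class R (u @ v)),
      monoid.one = word_class R []\<rparr>"

lemma equiv_word_cong: "equiv UNIV (word_cong R)"
proof (rule equivI)
  show "refl (word_cong R)" by (rule refl_onI) (rule word_cong.refl)
  show "sym (word_cong R)" by (rule symI) (rule word_cong.sym)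
  show "trans (word_cong R)" by (rule transI) (rule word_cong.trans)
qed simp

lemma word_class_eq_iff: "word_class R u = word_class R v \<longleftrightarrow> (u, v) \<in> word_cong R"
  using equiv_class_eq_iff[OF equiv_word_cong] by (auto simp: word_class_def)

lemma word_cong_context:
  assumes "(u, v) \<in> word_cong R"
  shows "(p @ u @ q, p @ v @ q) \<in> word_cong R"
  using assms
proof induction
  case (cancel p' a b q')
  show ?case
    using word_cong.cancel[of "p @ p'" a b "q' @ q" R] by simp
next
  case (rel l r p' q')
  then show ?case
    using word_cong.rel[of l r R "p @ p'" "q' @ q"] by simp
qed (blast intro: word_cong.refl word_cong.sym word_cong.trans)+

lemma word_cong_append:
  assumes "(u, u') \<in> word_cong R" "(v, v') \<in> word_cong R"
  shows "(u @ v, u' @ v') \<in> word_cong R"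
  using word_cong_context[OF assms(1), of "[]" v] word_cong_context[OF assms(2), of u' "[]"]
  by (simp add: word_cong.trans[of "u @ v" "u' @ v"])

lemma carrier_presented_group: "carrier (presented_group R) = range (word_class R)"
  by (auto simp: presented_group_def quotient_def word_class_def)

lemma one_presented_group: "\<one>\<^bsub>presented_group R\<^esub> = word_class R []"
  by (simp add: presented_group_def)

lemma mult_presented_group:
  "word_class R u \<otimes>\<^bsub>presented_group R\<^esub> word_class R v = word_class R (u @ v)"
proof -
  have *: "word_class R (u' @ v') = word_class R (u @ v)"
    if "u' \<in> word_class R u" "v' \<in> word_class R v" for u' v'
  proof -
    have "(u, u') \<in> word_cong R" "(v, v') \<in> word_cong R"
      using that by (simp_all add: word_class_def)
    then show ?thesis
      unfolding word_class_eq_iff by (intro word_cong.sym[OF word_cong_append])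
  qed
  have "u \<in> word_class R u" "v \<in> word_class R v"
    by (simp_all add: word_class_def word_cong.refl)
  then have "(\<Union>u'\<in>word_class R u. \<Union>v'\<in>word_class R v. word_class R (u' @ v')) =
      word_class R (u @ v)"
    using * by blast
  then show ?thesis
    by (simp add: presented_group_def)
qed

lemma word_cong_inverse:
  "(map (\<lambda>(a, b). (a, \<not> b)) (rev w) @ w, []) \<in> word_cong R"
proof (induction w)
  case Nil
  show ?case by (simp add: word_cong.refl)
next
  case (Cons x w)
  obtain a b where x: "x = (a, b)" by fastforce
  have "(map (\<lambda>(a, b). (a, \<not> b)) (rev w) @ [(a, \<not> b), (a, \<not> \<not> b)] @ w,
         map (\<lambda>(a, b). (a, \<not> b)) (rev w) @ w) \<in> word_cong R"
    by (rule word_cong.cancel)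
  from word_cong.trans[OF this Cons] show ?case
    by (simp add: x)
qed

lemma group_presented_group: "group (presented_group R)"
proof (rule groupI)
  fix x assume "x \<in> carrier (presented_group R)"
  then obtain w where "x = word_class R w" by (auto simp: carrier_presented_group)
  then show "\<exists>y\<in>carrier (presented_group R). y \<otimes>\<^bsub>presented_group R\<^esub> x = \<one>\<^bsub>presented_group R\<^esub>"
    using word_cong_inverse[of w R]
    by (auto simp: carrier_presented_group one_presented_group mult_presented_group
        word_class_eq_iff)
qed (auto simp: carrier_presented_group one_presented_group mult_presented_group)


section \<open>Thompson's group F\<close>

definition thompson_rels :: "(nat gword \<times> nat gword) set" where
  "thompson_rels =
     {([(k, True), (n, True)], [(n + 1, True), (k, True)]) | k n. k < n}"

definition thompson_F :: "nat gword set monoid" where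
  "thompson_F = presented_group thompson_rels"

definition xgen :: "nat \<Rightarrow> nat gword set" where
  "xgen n = word_class thompson_rels [(n, True)]"

lemma group_thompson_F: "group thompson_F"
  by (simp add: thompson_F_def group_presented_group)

lemma xgen_closed: "xgen n \<in> carrier thompson_F"
  by (simp add: thompson_F_def xgen_def carrier_presented_group)

lemma thompson_relation:
  assumes "k < n"
  shows "xgen k \<otimes>\<^bsub>thompson_F\<^esub> xgen n = xgen (n + 1) \<otimes>\<^bsub>thompson_F\<^esub> xgen k"
proof -
  have "([(k, True), (n, True)], [(n + 1, True), (k, True)]) \<in> thompson_rels"
    using assms by (auto simp: thompson_rels_def)
  from word_cong.rel[OF this, of "[]" "[]"] show ?thesis
    by (simp add: thompson_F_def xgen_def mult_presented_group word_class_eq_iff)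
qed

text \<open>
  The words over \<open>{x\<^sub>0, x\<^sub>1}\<close> are positive: inverse letters do not occur in them.
\<close>

definition thompson_S :: "nat gword set set" where
  "thompson_S =
     {xgen n \<otimes>\<^bsub>thompson_F\<^esub> foldr (\<otimes>\<^bsub>thompson_F\<^esub>) u \<one>\<^bsub>thompson_F\<^esub> | n u.
        u \<in> lists {xgen 0, xgen 1}}"


section \<open>Cayley graphs and the Cheeger constant\<close>

definition right_cayley_graph ::
  "('a, 'b) monoid_scheme \<Rightarrow> 'a set \<Rightarrow> ('a, 'a \<times> 'a) pre_digraph" where
  "right_cayley_graph G X =
     \<lparr>verts = carrier G, arcs = carrier G \<times> X, tail = fst, head = (\<lambda>(g, x). g \<otimes>\<^bsub>G\<^esub> x)\<rparr>"

definition neighbours :: "('v, 'e) pre_digraph \<Rightarrow> 'v \<Rightarrow> 'v \<Rightarrow> bool" where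
  "neighbours G u v \<longleftrightarrow> u \<rightarrow>\<^bsub>G\<^esub> v \<or> v \<rightarrow>\<^bsub>G\<^esub> u"

definition vertex_boundary :: "('v, 'e) pre_digraph \<Rightarrow> 'v set \<Rightarrow> 'v set" where
  "vertex_boundary G A = {v \<in> verts G - A. \<exists>a\<in>A. neighbours G v a}"

text \<open>
  Meant for infinite graphs of bounded degree: there the infimum is over a nonempty set of
  nonnegative reals, and every \<open>vertex_boundary G A\<close> is finite, so that \<open>card\<close> is its true size.
\<close>

definition cheeger_constant :: "('v, 'e) pre_digraph \<Rightarrow> real" where
  "cheeger_constant G =
     Inf {real (card (vertex_boundary G A)) / real (card A) | A.
            A \<subseteq> verts G \<and> A \<noteq> {} \<and> finite A}"

definition amenable_graph :: "('v, 'e) pre_digraph \<Rightarrow> bool" where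
  "amenable_graph G \<longleftrightarrow> cheeger_constant G = 0"

abbreviation non_amenable_graph :: "('v, 'e) pre_digraph \<Rightarrow> bool" where
  "non_amenable_graph G \<equiv> \<not> amenable_graph G"

definition Gamma_S :: "(nat gword set, nat gword set \<times> nat gword set) pre_digraph" where
  "Gamma_S = right_cayley_graph thompson_F {xgen 0, xgen 1} \<restriction> thompson_S"

text \<open>
  \<open>Gamma_S\<close> is infinite (by the exponent-sum homomorphism to the integers) and its vertex
  boundaries of finite sets are finite, so its Cheeger constant is the intended one.
\<close>

lemma thompson_exponent_sum:
  assumes "(u, v) \<in> word_cong thompson_rels"
  shows "(\<Sum>(a, b)\<leftarrow>u. if b then 1 else - 1 :: int) = (\<Sum>(a, b)\<leftarrow>v. if b then 1 else - 1)"
  using assms by induction (auto simp: thompson_rels_def)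

lemma foldr_xgen_replicate:
  "foldr (\<otimes>\<^bsub>thompson_F\<^esub>) (replicate m (xgen 0)) \<one>\<^bsub>thompson_F\<^esub> =
     word_class thompson_rels (replicate m (0, True))"
  by (induction m)
    (simp_all add: thompson_F_def one_presented_group xgen_def mult_presented_group)

lemma infinite_verts_Gamma_S: "infinite (verts Gamma_S)"
proof -
  let ?f = "\<lambda>m. word_class thompson_rels (replicate (Suc m) (0, True))"
  have "inj ?f"
  proof (rule injI)
    fix m m' assume "?f m = ?f m'"
    from thompson_exponent_sum[OF this[unfolded word_class_eq_iff]]
    show "m = m'" by (simp add: sum_list_replicate)
  qed
  moreover have "range ?f \<subseteq> verts Gamma_S"
  proof
    fix y assume "y \<in> range ?f"
    then obtain m where "y = ?f m" by blast
    also have "\<dots> = xgen 0 \<otimes>\<^bsub>thompson_F\<^esub>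
        foldr (\<otimes>\<^bsub>thompson_F\<^esub>) (replicate m (xgen 0)) \<one>\<^bsub>thompson_F\<^esub>"
      unfolding foldr_xgen_replicate
      by (simp add: thompson_F_def xgen_def mult_presented_group)
    finally show "y \<in> verts Gamma_S"
      unfolding Gamma_S_def induce_subgraph_verts thompson_S_def by fastforce
  qed
  ultimately show ?thesis
    using finite_subset range_inj_infinite by blast
qed

lemma finite_vertex_boundary_Gamma_S:
  assumes "finite A"
  shows "finite (vertex_boundary Gamma_S A)"
proof -
  interpret group thompson_F by (rule group_thompson_F)
  have "vertex_boundary Gamma_S A \<subseteq>
    (\<lambda>(a, x). a \<otimes>\<^bsub>thompson_F\<^esub> x) ` (A \<times> {xgen 0, xgen 1}) \<union>
    (\<lambda>(a, x). a \<otimes>\<^bsub>thompson_F\<^esub> inv\<^bsub>thompson_F\<^esub> x) ` (A \<times> {xgen 0, xgen 1})"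
  proof
    fix v assume "v \<in> vertex_boundary Gamma_S A"
    then obtain a where a: "a \<in> A" "neighbours Gamma_S v a"
      unfolding vertex_boundary_def by blast
    have arc: "\<exists>x\<in>{xgen 0, xgen 1}. g \<in> carrier thompson_F \<and> h = g \<otimes>\<^bsub>thompson_F\<^esub> x"
      if "(g, h) \<in> arcs_ends Gamma_S" for g h
    proof -
      obtain e where e: "e \<in> arcs Gamma_S" "g = tail Gamma_S e" "h = head Gamma_S e"
        using \<open>(g, h) \<in> arcs_ends Gamma_S\<close> unfolding arcs_ends_def arc_to_ends_def by blast
      moreover obtain g' x where "e = (g', x)" by (cases e)
      ultimately have "g' \<in> carrier thompson_F" "x \<in> {xgen 0, xgen 1}" "g = g'"
          "h = g' \<otimes>\<^bsub>thompson_F\<^esub> x"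
        by (simp_all add: Gamma_S_def right_cayley_graph_def induce_subgraph_def)
      then show ?thesis by blast
    qed
    consider x where "x \<in> {xgen 0, xgen 1}" "v = a \<otimes>\<^bsub>thompson_F\<^esub> x"
      | x where "x \<in> {xgen 0, xgen 1}" "v \<in> carrier thompson_F" "a = v \<otimes>\<^bsub>thompson_F\<^esub> x"
      using a(2) arc[of a v] arc[of v a] unfolding neighbours_def by blast
    then show "v \<in> (\<lambda>(a, x). a \<otimes>\<^bsub>thompson_F\<^esub> x) ` (A \<times> {xgen 0, xgen 1}) \<union>
      (\<lambda>(a, x). a \<otimes>\<^bsub>thompson_F\<^esub> inv\<^bsub>thompson_F\<^esub> x) ` (A \<times> {xgen 0, xgen 1})"
    proof cases
      case (1 x)
      then show ?thesis using a(1) by (intro UnI1 image_eqI[of _ _ "(a, x)"]) simp_all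
    next
      case (2 x)
      then have "x \<in> carrier thompson_F" using xgen_closed by blast
      then have "v = a \<otimes>\<^bsub>thompson_F\<^esub> inv\<^bsub>thompson_F\<^esub> x"
        using 2 by (simp add: m_assoc)
      then show ?thesis using a(1) 2(1) by (intro UnI2 image_eqI[of _ _ "(a, x)"]) simp_all
    qed
  qed
  then show ?thesis
    by (rule finite_subset) (simp add: assms)
qed

end

theory Submission
  imports Defs
begin

text \<open>
  Each of \<open>S x\<^sub>0\<close> and \<open>S x\<^sub>1\<close> lies in \<open>S\<close>, so a finite \<open>A \<subseteq> S\<close> has boundary at least
  \<open>|A x\<^sub>0 \<union> A x\<^sub>1| - |A| = |A| - |A x\<^sub>0 \<inter> A x\<^sub>1|\<close>. Let \<open>M\<close> be the submonoid generated by \<open>x\<^sub>0, x\<^sub>1\<close>.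
  If \<open>a x\<^sub>0 = b x\<^sub>1\<close> with \<open>a, b \<in> S\<close>, then \<open>a = u x\<^sub>2\<close> and \<open>b = u x\<^sub>0\<close> for some \<open>u \<in> M\<close>, whence
  \<open>a \<notin> M\<close> and \<open>b \<in> M\<close>. Therefore \<open>|A x\<^sub>0 \<inter> A x\<^sub>1|\<close> is at most both \<open>|A - M|\<close> and \<open>|A \<inter> M|\<close>, hence
  at most \<open>|A| / 2\<close>, and the Cheeger constant is at least \<open>1/2\<close>.

  The collisions are identified through a piecewise linear action of \<open>F\<close> on the real line: a
  positive element is a binary forest, its inverse maps the integer interval \<open>[i, i+1]\<close> to an
  interval of integer length, and this length is the number of leaves of the \<open>i\<close>-th tree.
\<close>

lemma right_translate_in_vertex_boundary:
  assumes "S \<subseteq> carrier G" "x \<in> X" "a \<in> A" "A \<subseteq> S" "a \<otimes>\<^bsub>G\<^esub> x \<in> S" "a \<otimes>\<^bsub>G\<^esub> x \<notin> A"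
  shows "a \<otimes>\<^bsub>G\<^esub> x \<in> vertex_boundary (right_cayley_graph G X \<restriction> S) A"
proof -
  let ?H = "right_cayley_graph G X \<restriction> S"
  have "(a, x) \<in> arcs ?H" "tail ?H (a, x) = a" "head ?H (a, x) = a \<otimes>\<^bsub>G\<^esub> x"
    using assms by (auto simp: right_cayley_graph_def induce_subgraph_def)
  then have "a \<rightarrow>\<^bsub>?H\<^esub> (a \<otimes>\<^bsub>G\<^esub> x)"
    unfolding arcs_ends_def arc_to_ends_def by (metis (no_types, lifting) image_eqI)
  then show ?thesis
    using assms unfolding vertex_boundary_def neighbours_def by auto
qed

lemma (in group) non_amenable_induced_cayley_graph:
  assumes S: "S \<subseteq> carrier G" "S \<noteq> {}"
    and x: "x \<in> carrier G" "\<And>a. a \<in> S \<Longrightarrow> a \<otimes> x \<in> S"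
    and y: "y \<in> carrier G" "\<And>a. a \<in> S \<Longrightarrow> a \<otimes> y \<in> S"
    and fin: "\<And>A. finite A \<Longrightarrow> finite (vertex_boundary (right_cayley_graph G {x, y} \<restriction> S) A)"
    and overlap: "\<And>a b. \<lbrakk>a \<in> S; b \<in> S; a \<otimes> x = b \<otimes> y\<rbrakk> \<Longrightarrow> a \<notin> M \<and> b \<in> M"
  shows "non_amenable_graph (right_cayley_graph G {x, y} \<restriction> S)"
proof -
  let ?H = "right_cayley_graph G {x, y} \<restriction> S"
  have bound: "1 / 2 \<le> real (card (vertex_boundary ?H A)) / real (card A)"
    if A: "A \<subseteq> S" "A \<noteq> {}" "finite A" for A
  proof -
    let ?Ax = "(\<lambda>a. a \<otimes> x) ` A" and ?Ay = "(\<lambda>a. a \<otimes> y) ` A"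
    have "inj_on (\<lambda>a. a \<otimes> z) A" if "z \<in> carrier G" for z
      using that A S by (intro inj_onI) (metis right_cancel subsetD)
    then have cards: "card ?Ax = card A" "card ?Ay = card A"
      using x(1) y(1) by (simp_all add: card_image)
    \<comment> \<open>A common point has the form a x = b y, and \<open>overlap\<close> puts a
      outside \<open>M\<close> and b inside it.\<close>
    have "?Ax \<inter> ?Ay \<subseteq> (\<lambda>a. a \<otimes> x) ` (A - M)" "?Ax \<inter> ?Ay \<subseteq> (\<lambda>a. a \<otimes> y) ` (A \<inter> M)"
      using overlap A(1) by blast+
    then have "card (?Ax \<inter> ?Ay) \<le> card (A - M)" "card (?Ax \<inter> ?Ay) \<le> card (A \<inter> M)"
      using A(3) by (meson card_image_le card_mono finite_Diff finite_Int finite_imageI le_trans)+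
    moreover have "card A = card (A - M) + card (A \<inter> M)"
      using A(3) by (metis add.commute card_Int_Diff)
    moreover have "card ?Ax + card ?Ay = card (?Ax \<union> ?Ay) + card (?Ax \<inter> ?Ay)"
      using A(3) by (intro card_Un_Int) auto
    moreover have "card (?Ax \<union> ?Ay) \<le> card ((?Ax \<union> ?Ay) - A) + card A"
      using diff_card_le_card_Diff[OF A(3), of "?Ax \<union> ?Ay"] by linarith
    \<comment> \<open>Monotonicity of \<open>card\<close> requires \<open>fin\<close>: an infinite
      boundary would have \<open>card\<close> 0.\<close>
    moreover have "card ((?Ax \<union> ?Ay) - A) \<le> card (vertex_boundary ?H A)"
    proof (rule card_mono[OF fin[OF A(3)]], rule subsetI)
      fix c assume "c \<in> (?Ax \<union> ?Ay) - A"
      then obtain a z where "a \<in> A" "z \<in> {x, y}" "c = a \<otimes> z" "c \<notin> A" by blast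
      then show "c \<in> vertex_boundary ?H A"
        using right_translate_in_vertex_boundary[of S G z "{x, y}" a A] S(1) A(1) x(2) y(2)
        by blast
    qed
    ultimately have "card A \<le> 2 * card (vertex_boundary ?H A)"
      using cards by linarith
    moreover have "card A > 0" using A by (simp add: card_gt_0_iff)
    ultimately show ?thesis by (simp add: field_simps)
  qed
  \<comment> \<open>\<open>Inf\<close> of the empty set is unspecified, so a singleton is exhibited
    to make the set of ratios nonempty.\<close>
  obtain s where "s \<in> S" using S(2) by blast
  then have "{s} \<subseteq> verts ?H \<and> {s} \<noteq> {} \<and> finite {s}" by simp
  then have "1 / 2 \<le> cheeger_constant ?H"
    unfolding cheeger_constant_def
  proof (intro cInf_greatest)
    fix r
    assume "r \<in> {real (card (vertex_boundary ?H A)) / real (card A) | A.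
      A \<subseteq> verts ?H \<and> A \<noteq> {} \<and> finite A}"
    then obtain A where "A \<subseteq> S" "A \<noteq> {}" "finite A"
      "r = real (card (vertex_boundary ?H A)) / real (card A)"
      by auto
    then show "1 / 2 \<le> r" using bound by blast
  qed blast
  then show ?thesis by (simp add: amenable_graph_def)
qed

text \<open>In forest terms, this joins trees n and n+1 by a caret: [n, n+1] is stretched over two
  unit intervals.\<close>

definition caret :: "nat \<Rightarrow> real \<Rightarrow> real" where
  "caret n t = (if t \<le> n then t else if t \<le> n + 1 then 2 * t - n else t + 1)"

definition uncaret :: "nat \<Rightarrow> real \<Rightarrow> real" where
  "uncaret n t = (if t \<le> n then t else if t \<le> n + 2 then (t + n) / 2 else t - 1)"

text \<open>
  With the convention \<open>(fg)(t) = g(f(t))\<close>, the group element represented by \<open>w\<close> acts by the inverse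
  of \<open>pl_action w\<close>; this way no order reversal is needed.
\<close>

definition pl_action :: "nat gword \<Rightarrow> real \<Rightarrow> real" where
  "pl_action w = foldr (\<lambda>(n, b). if b then caret n else uncaret n) w"

lemma caret_uncaret: "caret n (uncaret n t) = t"
  by (auto simp: caret_def uncaret_def field_simps)

lemma uncaret_caret: "uncaret n (caret n t) = t"
  by (auto simp: caret_def uncaret_def field_simps)

text \<open>The stretched intervals [k, k+1] and [n, n+1] do not overlap; stretching the left one
  first merely moves the right one to [n+1, n+2].\<close>

lemma caret_commute:
  assumes "k < n"
  shows "caret k (caret n t) = caret (n + 1) (caret k t)"
proof -
  have "real k + 1 \<le> real n" using assms by linarith
  then show ?thesis by (auto simp: caret_def)
qed

lemma caret_of_nat: "caret n (real i) = real (if i \<le> n then i else i + 1)"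
  by (auto simp: caret_def)

lemma pl_action_simps:
  "pl_action [] = id"
  "pl_action ((n, b) # w) = (if b then caret n else uncaret n) \<circ> pl_action w"
  "pl_action (u @ v) = pl_action u \<circ> pl_action v"
  by (simp_all add: pl_action_def fun_eq_iff)

lemma pl_action_cong:
  assumes "(u, v) \<in> word_cong thompson_rels"
  shows "pl_action u = pl_action v"
  using assms
proof induction
  case (cancel p a b q)
  then show ?case
    by (auto simp: pl_action_simps fun_eq_iff caret_uncaret uncaret_caret)
next
  case (rel l r p q)
  then show ?case
    using caret_commute by (auto simp: thompson_rels_def pl_action_simps fun_eq_iff)
qed simp_all

definition pos_word :: "nat list \<Rightarrow> nat gword" where
  "pos_word u = map (\<lambda>i. (i, True)) u"

definition pos_elem :: "nat list \<Rightarrow> nat gword set" where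
  "pos_elem u = word_class thompson_rels (pos_word u)"

lemma pos_elem_append: "pos_elem (u @ v) = pos_elem u \<otimes>\<^bsub>thompson_F\<^esub> pos_elem v"
  by (simp add: pos_elem_def pos_word_def thompson_F_def mult_presented_group)

lemma pos_elem_Cons: "pos_elem (n # u) = xgen n \<otimes>\<^bsub>thompson_F\<^esub> pos_elem u"
  by (simp add: pos_elem_def pos_word_def thompson_F_def mult_presented_group xgen_def)

lemma pos_elem_Nil: "pos_elem [] = \<one>\<^bsub>thompson_F\<^esub>"
  by (simp add: pos_elem_def pos_word_def thompson_F_def one_presented_group)

lemma pos_elem_closed: "pos_elem u \<in> carrier thompson_F"
  by (simp add: pos_elem_def thompson_F_def carrier_presented_group)

lemma pos_elem_snoc: "pos_elem (u @ [n]) = pos_elem u \<otimes>\<^bsub>thompson_F\<^esub> xgen n"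
  by (simp add: pos_elem_append) (simp add: pos_elem_def pos_word_def xgen_def)

lemma thompson_S_eq: "thompson_S = {pos_elem (n # u) | n u. set u \<subseteq> {0, 1}}"
proof -
  have foldr: "foldr (\<otimes>\<^bsub>thompson_F\<^esub>) (map xgen u) \<one>\<^bsub>thompson_F\<^esub> = pos_elem u" for u
    by (induction u) (simp_all add: pos_elem_Nil pos_elem_Cons)
  have lists: "lists {xgen 0, xgen 1} = map xgen ` lists {0, 1}"
    by (metis image_insert image_empty lists_image)
  have "thompson_S = {xgen n \<otimes>\<^bsub>thompson_F\<^esub>
      foldr (\<otimes>\<^bsub>thompson_F\<^esub>) (map xgen u) \<one>\<^bsub>thompson_F\<^esub> | n u. u \<in> lists {0, 1}}"
    unfolding thompson_S_def lists by blast
  then show ?thesis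
    by (simp add: pos_elem_Cons foldr lists_eq_set)
qed

text \<open>Each letter of \<open>u\<close> that the leading generator passes lowers its index by 1.
  The relation always applies, since the index never falls below 2.\<close>

lemma pos_elem_move_right:
  assumes "set u \<subseteq> {0, 1}" "2 \<le> n"
  shows "pos_elem ((n + length u) # u) = pos_elem (u @ [n])"
  using assms(1)
proof (induction u)
  case (Cons k u)
  interpret group thompson_F by (rule group_thompson_F)
  have "k < n + length u" using Cons.prems assms(2) by auto
  then have "xgen (n + length u + 1) \<otimes>\<^bsub>thompson_F\<^esub> xgen k =
      xgen k \<otimes>\<^bsub>thompson_F\<^esub> xgen (n + length u)"
    by (simp add: thompson_relation)
  then have "pos_elem ((n + length (k # u)) # k # u) =
      xgen k \<otimes>\<^bsub>thompson_F\<^esub> pos_elem ((n + length u) # u)"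
    by (simp add: pos_elem_Cons xgen_closed pos_elem_closed flip: m_assoc)
  then show ?case using Cons by (simp add: pos_elem_Cons)
qed simp

text \<open>Reading the count off the action, rather than off a forest datatype, makes it an
  invariant of the group element.\<close>

definition leaves :: "nat list \<Rightarrow> nat \<Rightarrow> real" where
  "leaves u i = pl_action (pos_word u) (real (i + 1)) - pl_action (pos_word u) (real i)"

lemma leaves_cong: "pos_elem u = pos_elem v \<Longrightarrow> leaves u = leaves v"
  by (simp add: pos_elem_def word_class_eq_iff leaves_def pl_action_cong fun_eq_iff)

lemma leaves_Nil: "leaves [] i = 1"
  by (simp add: leaves_def pos_word_def pl_action_simps)

text \<open>The last letter acts first, and on integers \<open>caret k\<close> skips the value k+1;
  so trees k and k+1 merge and later trees move down one place.\<close>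

lemma leaves_snoc:
  "leaves (u @ [k]) i =
    (if i < k then leaves u i else if i = k then leaves u k + leaves u (k + 1) else leaves u (i + 1))"
  using caret_of_nat[of k i] caret_of_nat[of k "i + 1"]
  by (auto simp: leaves_def pos_word_def pl_action_simps add_ac)

lemma leaves_ge_1: "1 \<le> leaves u i"
proof (induction u arbitrary: i rule: rev_induct)
  case (snoc k u)
  have "1 \<le> leaves u k + leaves u (k + 1)" using snoc[of k] snoc[of "k + 1"] by linarith
  then show ?case using snoc by (simp add: leaves_snoc)
qed (simp add: leaves_Nil)

text \<open>Every letter of \<open>u\<close> is below i, so it only renumbers the tree that ends at
  position i.\<close>

lemma leaves_append_01:
  assumes "set u \<subseteq> {0, 1}" "2 \<le> i"
  shows "leaves (v @ u) i = leaves v (i + length u)"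
  using assms
proof (induction u arbitrary: i rule: rev_induct)
  case (snoc k u)
  then have "k < i" "leaves (v @ u) (i + 1) = leaves v (i + 1 + length u)" by auto
  then show ?case by (simp add: leaves_snoc flip: append_assoc)
qed simp

lemma thompson_S_overlap:
  assumes "a \<in> thompson_S" "b \<in> thompson_S"
    and eq: "a \<otimes>\<^bsub>thompson_F\<^esub> xgen 0 = b \<otimes>\<^bsub>thompson_F\<^esub> xgen 1"
  shows "a \<notin> pos_elem ` lists {0, 1} \<and> b \<in> pos_elem ` lists {0, 1}"
proof -
  interpret group thompson_F by (rule group_thompson_F)
  obtain n u m v where a: "a = pos_elem (n # u)" and u: "set u \<subseteq> {0, 1}"
    and b: "b = pos_elem (m # v)"
    using assms unfolding thompson_S_eq by blast
  have "pos_elem ((n # u) @ [0]) = pos_elem ((m # v) @ [1])"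
    using eq unfolding pos_elem_snoc a b .
  \<comment> \<open>Position 1 separates the two sides: there \<open>x\<^sub>0\<close> only
    renumbers tree 2 of a, while \<open>x\<^sub>1\<close> merges trees 1 and 2 of b.\<close>
  then have "leaves ((n # u) @ [0]) 1 = leaves ((m # v) @ [1]) 1"
    by (rule fun_cong[OF leaves_cong])
  then have "leaves (n # u) 2 = leaves (m # v) 1 + leaves (m # v) 2"
    unfolding leaves_snoc by (simp add: numeral_2_eq_2)
  then have two: "2 \<le> leaves (n # u) 2"
    using leaves_ge_1[of "m # v" 1] leaves_ge_1[of "m # v" 2] by linarith
  have a_notin: "a \<noteq> pos_elem w" if "set w \<subseteq> {0, 1}" for w
  proof
    assume "a = pos_elem w"
    then have "leaves (n # u) 2 = leaves w 2" using a leaves_cong by metis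
    also have "\<dots> = 1" using leaves_append_01[OF that, of 2 "[]"] by (simp add: leaves_Nil)
    finally show False using two by simp
  qed
  \<comment> \<open>Tree 2 of a is tree 2 + |u| of the forest of \<open>x\<^sub>n\<close>, whose
    only tree with more than one leaf is tree n.\<close>
  have "n = 2 + length u"
  proof (rule ccontr)
    assume "n \<noteq> 2 + length u"
    then have "leaves ([] @ [n]) (2 + length u) = 1"
      unfolding leaves_snoc by (simp add: leaves_Nil)
    then show False using two leaves_append_01[OF u, of 2 "[n]"] by simp
  qed
  then have "a = pos_elem u \<otimes>\<^bsub>thompson_F\<^esub> xgen 2"
    using pos_elem_move_right[OF u, of 2] a by (simp add: pos_elem_snoc)
  then have "b \<otimes>\<^bsub>thompson_F\<^esub> xgen 1 = pos_elem u \<otimes>\<^bsub>thompson_F\<^esub> (xgen 2 \<otimes>\<^bsub>thompson_F\<^esub> xgen 0)"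
    using eq by (simp add: m_assoc pos_elem_closed xgen_closed)
  \<comment> \<open>This relation exposes a final \<open>x\<^sub>1\<close>, which can then be
    cancelled against the one after b.\<close>
  also have "xgen 2 \<otimes>\<^bsub>thompson_F\<^esub> xgen 0 = xgen 0 \<otimes>\<^bsub>thompson_F\<^esub> xgen 1"
    using thompson_relation[of 0 1] by (simp add: numeral_2_eq_2)
  finally have "b \<otimes>\<^bsub>thompson_F\<^esub> xgen 1 = pos_elem (u @ [0]) \<otimes>\<^bsub>thompson_F\<^esub> xgen 1"
    by (simp add: m_assoc pos_elem_closed xgen_closed pos_elem_snoc)
  then have "b = pos_elem (u @ [0])"
    using right_cancel b pos_elem_closed xgen_closed by metis
  then have "b \<in> pos_elem ` lists {0, 1}" using u by (auto simp: lists_eq_set)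
  then show ?thesis using a_notin by (auto simp: lists_eq_set)
qed

theorem proposition7:
  shows "non_amenable_graph Gamma_S"
proof -
  interpret group thompson_F by (rule group_thompson_F)
  have closed: "a \<otimes>\<^bsub>thompson_F\<^esub> xgen k \<in> thompson_S" if a: "a \<in> thompson_S" and k: "k \<in> {0, 1}" for a k
  proof -
    obtain n u where "a = pos_elem (n # u)" "set u \<subseteq> {0, 1}"
      using a unfolding thompson_S_eq by blast
    then have "a \<otimes>\<^bsub>thompson_F\<^esub> xgen k = pos_elem (n # (u @ [k]))" "set (u @ [k]) \<subseteq> {0, 1}"
      using k pos_elem_snoc[of "n # u" k] by auto
    then show ?thesis unfolding thompson_S_eq by blast
  qed
  have "thompson_S \<subseteq> carrier thompson_F" "thompson_S \<noteq> {}"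
    using pos_elem_closed by (auto simp: thompson_S_eq intro: exI[of _ "[]"])
  from non_amenable_induced_cayley_graph[OF this xgen_closed closed xgen_closed closed
      finite_vertex_boundary_Gamma_S[unfolded Gamma_S_def] thompson_S_overlap]
  show ?thesis by (simp add: Gamma_S_def)
qed

end
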